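(* Let $t>3$ be an odd integer. Then $\chi_2(G_t)=5$ if $t\equiv 1$ or $9 \pmod{10}$, and $\chi_2(G_t)=6$ if $t\equiv 3,5$ or $7\pmod{10}$. Moreover, $\chi_2(G_3)=7$.
   Context: For an odd integer $t\ge 3$, $G_t$ denotes the integer distance graph $G(\mathbb{Z},\{2,t\})$: its vertex set is $\mathbb{Z}$, and distinct $i,j\in\mathbb{Z}$ are adjacent if and only if $|i-j|\in\{2,t\}$. For a graph $G$, a $2$-distance $k$-coloring is a map $f:V(G)\to\{1,\ldots,k\}$ such that any two distinct vertices $u,v$ with $f(u)=f(v)$ satisfy $d_G(u,v)>2$ ($d_G$ the shortest-path distance); $\chi_2(G)$ is the smallest such $k$. *)

theory Defs
  imports Main "HOL-Library.Extended_Nat" "HOL-Number_Theory.Cong"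
begin

record 'a graph =
  verts :: "'a set"
  edges :: "('a \<times> 'a) set"

text \<open>Undirected edges are represented by a symmetric relation; \<open>(u, v) \<in> edges G ^^ n\<close> says that
  there is a walk of length \<open>n\<close> from \<open>u\<close> to \<open>v\<close>.  The distance is \<open>\<infinity>\<close> if there is none.\<close>

definition graph_dist :: "'a graph \<Rightarrow> 'a \<Rightarrow> 'a \<Rightarrow> enat" where
  "graph_dist G u v = Inf {enat n | n. (u, v) \<in> edges G ^^ n}"

definition two_distance_coloring :: "'a graph \<Rightarrow> nat \<Rightarrow> ('a \<Rightarrow> nat) \<Rightarrow> bool" where
  "two_distance_coloring G k f \<longleftrightarrow>
     (\<forall>v \<in> verts G. f v \<in> {1..k}) \<and>
     (\<forall>u \<in> verts G. \<forall>v \<in> verts G. u \<noteq> v \<and> f u = f v \<longrightarrow> graph_dist G u v > 2)"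

text \<open>The value is \<open>\<infinity>\<close> if no finite number of colors suffices.\<close>

definition chi2 :: "'a graph \<Rightarrow> enat" where
  "chi2 G = Inf {enat k | k. \<exists>f. two_distance_coloring G k f}"

definition distance_graph :: "int set \<Rightarrow> int graph" where
  "distance_graph D = \<lparr>verts = UNIV, edges = {(i, j). i \<noteq> j \<and> \<bar>i - j\<bar> \<in> D}\<rparr>"

definition Gt :: "int \<Rightarrow> int graph" where
  "Gt t = distance_graph {2, t}"

end

theory Submission
  imports Defs
begin

text \<open>
  Write \<open>a = 2\<close> and \<open>b = t\<close>.  In a coloring with five colors every closed neighborhood
  \<open>{z, z \<plusminus> a, z \<plusminus> b}\<close> contains each color exactly once, so the color classes are perfect codes.
  Looking at the neighborhoods of \<open>y + a + b\<close> and \<open>y + a - b\<close>, one sees that a codeword \<open>y\<close> has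
  a codeword a knight's move \<open>2a + b\<close> or \<open>2b + a\<close> away, and that a knight's move to a codeword can
  be turned by a right angle.  Hence the code contains a coset of the subgroup generated by
  \<open>2a + b\<close> and \<open>a - 2b\<close>, or of the mirror image of that subgroup.  If both pairs of generators are
  coprime, the code is all of \<open>\<int>\<close>, which is absurd; for \<open>b = t\<close> odd this happens unless
  \<open>t \<equiv> \<plusminus>1 (mod 5)\<close>.

  Conversely, \<open>i \<mapsto> \<lfloor>(q i mod p) / q\<rfloor>\<close> separates \<open>i\<close> from \<open>i + d\<close> as soon as \<open>q d\<close> is at circular
  distance at least \<open>q\<close> from \<open>0\<close> modulo \<open>p\<close>.  The choice \<open>q = 1\<close> gives all colorings needed,
  except for six colors and \<open>3\<close> dividing \<open>t\<close>, where \<open>p = t + 1\<close> and \<open>q = (t + 3) / 6\<close>; then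
  the differences to be avoided are congruent to one of \<open>\<plusminus>1, \<dots>, \<plusminus>4\<close> modulo \<open>p\<close>, and
  \<open>5q \<le> p \<le> 6q\<close>.  For \<open>t = 3\<close>, any seven consecutive integers are pairwise at distance at most 2.
\<close>

section \<open>Graphs\<close>

lemma graph_dist_le_iff:
  "graph_dist G u v \<le> enat n \<longleftrightarrow> (\<exists>m\<le>n. (u, v) \<in> edges G ^^ m)"
proof -
  have "enat n < graph_dist G u v \<longleftrightarrow> enat (Suc n) \<le> graph_dist G u v"
    by (simp add: Suc_ile_eq)
  also have "\<dots> \<longleftrightarrow> (\<forall>m. (u, v) \<in> edges G ^^ m \<longrightarrow> n < m)"
    by (auto simp: graph_dist_def le_Inf_iff Suc_le_eq)
  finally show ?thesis by (meson not_le)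
qed

lemma graph_dist_le_2_iff:
  "graph_dist G u v \<le> 2 \<longleftrightarrow> u = v \<or> (u, v) \<in> edges G \<or> (u, v) \<in> edges G O edges G"
proof -
  have "(\<exists>m\<le>2. P m) \<longleftrightarrow> P 0 \<or> P 1 \<or> P 2" for P :: "nat \<Rightarrow> bool"
    by (auto simp: numeral_2_eq_2 le_Suc_eq)
  then have "graph_dist G u v \<le> 2 \<longleftrightarrow>
      (u, v) \<in> edges G ^^ 0 \<or> (u, v) \<in> edges G ^^ 1 \<or> (u, v) \<in> edges G ^^ 2"
    unfolding numeral_eq_enat graph_dist_le_iff .
  moreover have "edges G ^^ 2 = edges G O edges G"
    by (simp add: numeral_2_eq_2)
  ultimately show ?thesis by simp
qed

lemma chi2_eqI:
  assumes "two_distance_coloring G k f"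
    and "\<And>j g. two_distance_coloring G j g \<Longrightarrow> k \<le> j"
  shows "chi2 G = enat k"
  unfolding chi2_def
proof (rule antisym)
  show "Inf {enat k | k. \<exists>f. two_distance_coloring G k f} \<le> enat k"
    using assms(1) by (intro Inf_lower) blast
  show "enat k \<le> Inf {enat k | k. \<exists>f. two_distance_coloring G k f}"
    using assms(2) by (intro Inf_greatest) auto
qed

lemma two_distance_coloring_inj_on:
  assumes "two_distance_coloring G k f" "S \<subseteq> verts G" "pairwise (\<lambda>u v. graph_dist G u v \<le> 2) S"
  shows "inj_on f S"
  using assms unfolding two_distance_coloring_def pairwise_def inj_on_def
  by (meson not_le subsetD)

lemma two_distance_coloring_image_subset:
  assumes "two_distance_coloring G k f" "S \<subseteq> verts G"
  shows "f ` S \<subseteq> {1..k}"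
  using assms unfolding two_distance_coloring_def by blast

lemma card_le_two_distance_coloring:
  assumes "two_distance_coloring G k f" "S \<subseteq> verts G" "pairwise (\<lambda>u v. graph_dist G u v \<le> 2) S"
  shows "card S \<le> k"
  using card_inj_on_le[OF two_distance_coloring_inj_on[OF assms]
      two_distance_coloring_image_subset[OF assms(1,2)]]
  by simp

lemma two_distance_coloring_image_eq:
  assumes "two_distance_coloring G (card S) f" "S \<subseteq> verts G"
    and "pairwise (\<lambda>u v. graph_dist G u v \<le> 2) S"
  shows "f ` S = {1..card S}"
  using two_distance_coloring_image_subset[OF assms(1,2)]
    card_image[OF two_distance_coloring_inj_on[OF assms]]
  by (intro card_subset_eq) auto

definition closed_neighborhood :: "'a graph \<Rightarrow> 'a \<Rightarrow> 'a set" where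
  "closed_neighborhood G v = insert v (edges G `` {v})"

definition perfect_code :: "'a graph \<Rightarrow> 'a set \<Rightarrow> bool" where
  "perfect_code G C \<longleftrightarrow>
     C \<subseteq> verts G \<and> (\<forall>v\<in>verts G. \<exists>!c. c \<in> C \<and> c \<in> closed_neighborhood G v)"

lemma pairwise_graph_dist_closed_neighborhood:
  assumes "sym (edges G)"
  shows "pairwise (\<lambda>u v. graph_dist G u v \<le> 2) (closed_neighborhood G v)"
  using assms by (auto simp: pairwise_def closed_neighborhood_def graph_dist_le_2_iff dest: symD)

lemma perfect_code_color_class:
  assumes coloring: "two_distance_coloring G k f" and "c \<in> {1..k}"
    and sym: "sym (edges G)" and edges: "edges G \<subseteq> verts G \<times> verts G"
    and card: "\<And>v. v \<in> verts G \<Longrightarrow> card (closed_neighborhood G v) = k"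
  shows "perfect_code G {v \<in> verts G. f v = c}"
  unfolding perfect_code_def
proof (intro conjI ballI)
  fix v assume v: "v \<in> verts G"
  let ?N = "closed_neighborhood G v"
  have subset: "?N \<subseteq> verts G"
    using v edges by (auto simp: closed_neighborhood_def)
  note close = pairwise_graph_dist_closed_neighborhood[OF sym, of v]
  have "f ` ?N = {1..k}"
    using two_distance_coloring_image_eq[OF _ subset close] coloring card[OF v] by simp
  then obtain u where "u \<in> ?N" "f u = c"
    using \<open>c \<in> {1..k}\<close> by (metis imageE)
  moreover have "inj_on f ?N"
    using two_distance_coloring_inj_on[OF coloring subset close] .
  ultimately show "\<exists>!u. u \<in> {v \<in> verts G. f v = c} \<and> u \<in> ?N"
    using subset by (intro ex1I[of _ u]) (auto dest: inj_onD)
qed auto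

section \<open>Distance graphs\<close>

lemma verts_distance_graph [simp]: "verts (distance_graph D) = UNIV"
  by (simp add: distance_graph_def)

lemma edges_distance_graph: "(u, v) \<in> edges (distance_graph D) \<longleftrightarrow> u \<noteq> v \<and> \<bar>v - u\<bar> \<in> D"
  by (simp add: distance_graph_def abs_minus_commute)

lemma sym_edges_distance_graph: "sym (edges (distance_graph D))"
  by (auto simp: sym_def edges_distance_graph abs_minus_commute)

lemma closed_neighborhood_distance_graph:
  "closed_neighborhood (distance_graph D) z = {c. c = z \<or> \<bar>c - z\<bar> \<in> D}"
  by (auto simp: closed_neighborhood_def edges_distance_graph)

definition close_differences :: "int set \<Rightarrow> int set" where
  "close_differences D = {d. 0 < d \<and> (d \<in> D \<or> (\<exists>e. \<bar>e\<bar> \<in> D \<and> \<bar>d - e\<bar> \<in> D))}"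

lemma close_differences_pair:
  assumes "0 < a" "a < b"
  shows "close_differences {a, b} = {a, b, 2 * a, 2 * b, a + b, b - a}"
proof -
  have "(\<exists>e. \<bar>e\<bar> \<in> {a, b} \<and> \<bar>d - e\<bar> \<in> {a, b}) \<longleftrightarrow> d \<in> {2 * a, 2 * b, a + b, b - a}"
    if "0 < d" for d
  proof -
    have "(\<exists>e. \<bar>e\<bar> \<in> {a, b} \<and> \<bar>d - e\<bar> \<in> {a, b}) \<longleftrightarrow>
        (\<exists>e\<in>{a, - a, b, - b}. d - e \<in> {a, - a, b, - b})"
      using assms by (smt (verit) insert_iff empty_iff)
    also have "\<dots> \<longleftrightarrow> d \<in> {2 * a, 2 * b, a + b, b - a}"
      using assms that by simp linarith
    finally show ?thesis .
  qed
  then show ?thesis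
    using assms unfolding close_differences_def by auto
qed

lemma abs_in_close_differences_iff:
  "\<bar>x\<bar> \<in> close_differences D \<longleftrightarrow> x \<noteq> 0 \<and> (\<bar>x\<bar> \<in> D \<or> (\<exists>e. \<bar>e\<bar> \<in> D \<and> \<bar>x - e\<bar> \<in> D))"
proof (cases "0 \<le> x")
  case False
  then have "\<bar>\<bar>x\<bar> - e\<bar> = \<bar>x - (- e)\<bar>" for e by simp
  then have "(\<exists>e. \<bar>e\<bar> \<in> D \<and> \<bar>\<bar>x\<bar> - e\<bar> \<in> D) \<longleftrightarrow> (\<exists>e. \<bar>e\<bar> \<in> D \<and> \<bar>x - e\<bar> \<in> D)"
    by (metis abs_minus_cancel minus_minus)
  then show ?thesis by (simp add: close_differences_def)
qed (auto simp: close_differences_def)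

lemma graph_dist_distance_graph_le_2_iff:
  "graph_dist (distance_graph D) u v \<le> 2 \<longleftrightarrow> u = v \<or> \<bar>v - u\<bar> \<in> close_differences D"
proof (cases "u = v")
  case False
  let ?E = "edges (distance_graph D)"
  have "(u, v) \<in> ?E \<or> (u, v) \<in> ?E O ?E" if "\<bar>e\<bar> \<in> D" "\<bar>v - u - e\<bar> \<in> D" for e
  proof -
    have "(u, u + e) \<in> ?E \<or> e = 0" "(u + e, v) \<in> ?E \<or> u + e = v"
      using that by (auto simp: edges_distance_graph algebra_simps)
    moreover have "(u, v) \<in> ?E" if "e = 0 \<or> u + e = v"
      using that False \<open>\<bar>e\<bar> \<in> D\<close> \<open>\<bar>v - u - e\<bar> \<in> D\<close> by (auto simp: edges_distance_graph)
    ultimately show ?thesis by blast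
  qed
  moreover have "\<exists>e. \<bar>e\<bar> \<in> D \<and> \<bar>v - u - e\<bar> \<in> D" if "(u, w) \<in> ?E" "(w, v) \<in> ?E" for w
    using that by (intro exI[of _ "w - u"]) (simp add: edges_distance_graph)
  moreover have "(u, v) \<in> ?E \<longleftrightarrow> \<bar>v - u\<bar> \<in> D"
    using False by (simp add: edges_distance_graph)
  ultimately show ?thesis
    using False unfolding graph_dist_le_2_iff abs_in_close_differences_iff by auto
qed (simp add: graph_dist_le_2_iff)

lemma two_distance_coloring_distance_graphI:
  assumes "\<And>v. f v \<in> {1..k}"
    and neq: "\<And>d v. d \<in> close_differences D \<Longrightarrow> f (v + d) \<noteq> f v"
  shows "two_distance_coloring (distance_graph D) k f"
proof -
  have "\<bar>v - u\<bar> \<notin> close_differences D" if "f u = f v" for u v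
    using that neq[of "v - u" u] neq[of "u - v" v] by (auto simp: abs_if)
  then show ?thesis
    using assms(1)
    by (auto simp: two_distance_coloring_def graph_dist_distance_graph_le_2_iff simp flip: not_le)
qed

section \<open>Circular colorings\<close>

definition circular_coloring :: "int \<Rightarrow> int \<Rightarrow> int \<Rightarrow> nat" where
  "circular_coloring p q i = nat (q * i mod p div q) + 1"

lemma circular_coloring_range:
  assumes "0 < p" "0 < q" "p \<le> int k * q"
  shows "circular_coloring p q i \<in> {1..k}"
proof -
  have "q * (q * i mod p div q) \<le> q * i mod p"
    using assms(2) by (smt (verit) div_mult_mod_eq mult.commute pos_mod_sign)
  also have "\<dots> < q * int k"
    using assms(3) pos_mod_bound[OF assms(1), of "q * i"] by (simp add: mult.commute[of q "int k"])
  finally have "q * i mod p div q < int k"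
    using assms(2) by simp
  then show ?thesis
    using assms by (simp add: circular_coloring_def nat_less_iff pos_imp_zdiv_nonneg_iff Suc_le_eq)
qed

lemma circular_coloring_neq:
  assumes "0 < q" "[q * d = r] (mod p)" "r \<in> {q..p - q}"
  shows "circular_coloring p q (i + d) \<noteq> circular_coloring p q i"
proof
  define x y where "x = q * i mod p" and "y = q * (i + d) mod p"
  assume "circular_coloring p q (i + d) = circular_coloring p q i"
  moreover have bounds: "0 \<le> x" "x < p" "0 \<le> y" "y < p"
    using assms(1,3) by (simp_all add: x_def y_def)
  ultimately have "y div q = x div q"
    using assms(1)
    by (simp add: circular_coloring_def eq_nat_nat_iff pos_imp_zdiv_nonneg_iff flip: x_def y_def)
  then have "y - x = y mod q - x mod q"
    by (simp flip: minus_mult_div_eq_mod)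
  then have "\<bar>y - x\<bar> < q"
    using assms(1) pos_mod_sign[of q x] pos_mod_bound[of q x] pos_mod_sign[of q y]
      pos_mod_bound[of q y]
    by linarith
  moreover have "(y - x) mod p = r"
  proof -
    have "(y - x) mod p = (q * d) mod p"
      by (simp add: x_def y_def mod_diff_eq distrib_left)
    also have "\<dots> = r" using assms by (simp add: cong_def)
    finally show ?thesis .
  qed
  moreover have "(y - x) mod p = (if x \<le> y then y - x else y - x + p)"
    using bounds mod_pos_pos_trivial[of "y - x" p] mod_pos_pos_trivial[of "y - x + p" p] by simp
  ultimately show False using assms(3) by (auto split: if_splits)
qed

lemma two_distance_coloring_circular:
  assumes "0 < p" "0 < q" "p \<le> int k * q"
    and "\<And>d. d \<in> close_differences D \<Longrightarrow> \<exists>r\<in>{q..p - q}. [q * d = r] (mod p)"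
  shows "two_distance_coloring (distance_graph D) k (circular_coloring p q)"
proof (rule two_distance_coloring_distance_graphI)
  show "circular_coloring p q i \<in> {1..k}" for i
    using circular_coloring_range[OF assms(1-3)] .
  show "circular_coloring p q (i + d) \<noteq> circular_coloring p q i"
    if "d \<in> close_differences D" for d i
    using assms(4)[OF that] circular_coloring_neq[OF assms(2)] by blast
qed

lemma ex_residue_if_cong_small:
  fixes q e m p d :: int
  assumes "0 \<le> q" "e \<in> {1..m}" "(m + 1) * q \<le> p" "[d = e] (mod p) \<or> [d = - e] (mod p)"
  shows "\<exists>r\<in>{q..p - q}. [q * d = r] (mod p)"
proof -
  have "q * 1 \<le> q * e" "q * e \<le> q * m"
    using assms(1,2) by (intro mult_left_mono; simp)+
  then have "q * e \<in> {q..p - q}" "p - q * e \<in> {q..p - q}"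
    using assms(3) by (simp_all add: algebra_simps)
  moreover have "[q * d = q * e] (mod p) \<or> [q * d = q * - e] (mod p)"
    using assms(4) cong_scalar_left by blast
  moreover have "[q * - e = p - q * e] (mod p)"
    by (simp add: cong_iff_dvd_diff)
  ultimately show ?thesis using cong_trans by blast
qed

lemma two_distance_coloring_mod:
  assumes "0 < m" and "\<And>d. d \<in> close_differences D \<Longrightarrow> \<not> int m dvd d"
  shows "two_distance_coloring (distance_graph D) m (circular_coloring (int m) 1)"
proof (rule two_distance_coloring_circular)
  fix d assume "d \<in> close_differences D"
  then have "d mod int m \<noteq> 0" using assms(2) by (simp add: dvd_eq_mod_eq_0)
  moreover have "0 \<le> d mod int m" "d mod int m < int m" using assms(1) by simp_all
  ultimately have "d mod int m \<in> {1..int m - 1}" by simp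
  moreover have "[1 * d = d mod int m] (mod int m)" by (simp add: cong_def)
  ultimately show "\<exists>r\<in>{1..int m - 1}. [1 * d = r] (mod int m)" by blast
qed (use assms(1) in auto)

section \<open>Periods of a set\<close>

definition periods :: "'a::ab_group_add set \<Rightarrow> 'a set" where
  "periods S = {d. \<forall>x. x + d \<in> S \<longleftrightarrow> x \<in> S}"

lemma periodsD: "d \<in> periods S \<Longrightarrow> x + d \<in> S \<longleftrightarrow> x \<in> S"
  by (simp add: periods_def)

lemma periods_add:
  assumes "d \<in> periods S" "e \<in> periods S"
  shows "d + e \<in> periods S"
  using assms by (simp add: periods_def flip: add.assoc)

lemma periods_diff:
  assumes "d \<in> periods S" "e \<in> periods S"
  shows "d - e \<in> periods S"
proof -
  have "x + (d - e) \<in> S \<longleftrightarrow> x \<in> S" for x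
    using periodsD[OF assms(2), of "x + (d - e)"] periodsD[OF assms(1), of x]
    by (simp add: algebra_simps)
  then show ?thesis by (simp add: periods_def)
qed

lemma periods_int_mult:
  fixes d k :: int
  assumes "d \<in> periods S"
  shows "k * d \<in> periods S"
proof (induction k rule: int_induct[where k = 0])
  case base
  show ?case by (simp add: periods_def)
next
  case (step1 k)
  then show ?case using periods_add[OF _ assms] by (simp add: distrib_right)
next
  case (step2 k)
  then show ?case using periods_diff[OF _ assms] by (simp add: left_diff_distrib)
qed

lemma periods_gcd:
  fixes d e :: int
  assumes "d \<in> periods S" "e \<in> periods S"
  shows "gcd d e \<in> periods S"
proof -
  obtain u v where "u * d + v * e = gcd d e" using bezout_int by blast
  then show ?thesis using periods_add[OF assms[THEN periods_int_mult]] by metis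
qed

section \<open>Perfect codes of crosses\<close>

definition cross :: "'a::ab_group_add \<Rightarrow> 'a \<Rightarrow> 'a set" where
  "cross a b = {0, a, - a, b, - b}"

definition knights :: "'a::ab_group_add \<Rightarrow> 'a \<Rightarrow> 'a set \<Rightarrow> 'a set" where
  "knights a b C = {y \<in> C. y + (a + a + b) \<in> C}"

locale cross_code =
  fixes a b :: "'a::ab_group_add" and C :: "'a set"
  assumes distinct: "distinct [0, a, - a, b, - b]"
    and unique_cover: "\<exists>!c. c \<in> C \<and> c - z \<in> cross a b"
begin

lemma rotate: "cross_code (- b) a C"
proof -
  have "cross (- b) a = cross a b" by (auto simp: cross_def)
  then show ?thesis
    using distinct unique_cover by unfold_locales auto
qed

lemma swap: "cross_code b a C"
proof -
  have "cross b a = cross a b" by (auto simp: cross_def)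
  then show ?thesis
    using distinct unique_cover by unfold_locales auto
qed

lemma codeword_near: "\<exists>d\<in>cross a b. z + d \<in> C"
  using unique_cover[of z] by (metis diff_add_cancel add.commute)

lemma codeword_unique:
  assumes "x \<in> C" "y \<in> C" "x - z \<in> cross a b" "y - z \<in> cross a b"
  shows "x = y"
  using unique_cover[of z] assms by blast

lemma add_notin:
  assumes "y \<in> C" "d \<in> cross a b" "e \<in> cross a b" "d \<noteq> e"
  shows "y + (d - e) \<notin> C"
  using codeword_unique[of y "y + (d - e)" "y - e"] assms by (auto simp: algebra_simps)

lemma code_subset_knights: "C \<subseteq> knights a b C \<union> knights b a C"
proof
  fix y assume y: "y \<in> C"
  have "y + a \<notin> C" "y + b \<notin> C" "y + (a + b) \<notin> C"
    using add_notin[OF y, of a 0] add_notin[OF y, of b 0] add_notin[OF y, of a "- b"] distinct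
    by (auto simp: cross_def)
  then show "y \<in> knights a b C \<union> knights b a C"
    using codeword_near[of "y + (a + b)"] y by (auto simp: cross_def knights_def algebra_simps)
qed

lemma knights_subset_rotate: "knights a b C \<subseteq> knights (- b) a C"
proof
  fix y assume "y \<in> knights a b C"
  then have y: "y \<in> C" and z: "y + (a + a + b) \<in> C" by (simp_all add: knights_def)
  have "y + a \<notin> C" "y - b \<notin> C" "y + (a - b) \<notin> C"
    using add_notin[OF y, of a 0] add_notin[OF y, of 0 b] add_notin[OF y, of a b] distinct
    by (auto simp: cross_def)
  moreover have "y + (a + a - b) \<notin> C"
    using add_notin[OF z, of "- b" b] distinct by (auto simp: cross_def algebra_simps)
  ultimately show "y \<in> knights (- b) a C"
    using codeword_near[of "y + (a - b)"] y by (auto simp: cross_def knights_def algebra_simps)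
qed

end

lemma knights_rotate:
  assumes "cross_code a b C"
  shows "knights (- b) a C = knights a b C"
proof
  note rotate1 = cross_code.rotate[OF assms]
  note rotate2 = cross_code.rotate[OF rotate1]
  note rotate3 = cross_code.rotate[OF rotate2]
  show "knights a b C \<subseteq> knights (- b) a C"
    using cross_code.knights_subset_rotate[OF assms] .
  have "knights (- b) a C \<subseteq> knights (- a) (- b) C"
    using cross_code.knights_subset_rotate[OF rotate1] .
  also have "\<dots> \<subseteq> knights b (- a) C"
    using cross_code.knights_subset_rotate[OF rotate2] by simp
  also have "\<dots> \<subseteq> knights a b C"
    using cross_code.knights_subset_rotate[OF rotate3] by simp
  finally show "knights (- b) a C \<subseteq> knights a b C" .
qed

lemma knight_move_in_periods:
  assumes "cross_code a b C"
  shows "a + a + b \<in> periods (knights a b C)"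
proof -
  have "knights (- a) (- b) C = knights a b C"
    using knights_rotate[OF assms] knights_rotate[OF cross_code.rotate[OF assms]] by simp
  moreover have "y + (a + a + b) \<in> knights (- a) (- b) C \<longleftrightarrow> y \<in> knights a b C" for y
    by (auto simp: knights_def algebra_simps)
  ultimately show ?thesis by (simp add: periods_def)
qed

lemma turned_knight_move_in_periods:
  assumes "cross_code a b C"
  shows "a - b - b \<in> periods (knights a b C)"
  using knight_move_in_periods[OF cross_code.rotate[OF assms]] knights_rotate[OF assms]
  by (simp add: algebra_simps)

lemma knights_eq_empty_if_coprime:
  fixes a b :: int
  assumes "cross_code a b C" "coprime (2 * a + b) (a - 2 * b)"
  shows "knights a b C = {}"
proof (rule ccontr)
  assume "knights a b C \<noteq> {}"
  then obtain y where y: "y \<in> knights a b C" by blast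
  have "gcd (a + a + b) (a - b - b) \<in> periods (knights a b C)"
    using knight_move_in_periods[OF assms(1)] turned_knight_move_in_periods[OF assms(1)]
    by (rule periods_gcd)
  then have "1 \<in> periods (knights a b C)"
    using assms(2) by (simp add: coprime_iff_gcd_eq_1 algebra_simps)
  then have "y + a \<in> knights a b C"
    using y periods_int_mult[of 1 _ a] by (simp add: periods_def)
  moreover have "y + a \<notin> C"
    using cross_code.add_notin[OF assms(1), of y a 0] cross_code.distinct[OF assms(1)] y
    by (auto simp: cross_def knights_def)
  ultimately show False by (simp add: knights_def)
qed

lemma no_cross_code_if_coprime:
  fixes a b :: int
  assumes "coprime (2 * a + b) (a - 2 * b)" "coprime (2 * b + a) (b - 2 * a)"
  shows "\<not> cross_code a b C"
proof
  assume code: "cross_code a b C"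
  have "C = {}"
    using cross_code.code_subset_knights[OF code] knights_eq_empty_if_coprime[OF code assms(1)]
      knights_eq_empty_if_coprime[OF cross_code.swap[OF code] assms(2)]
    by simp
  then show False using cross_code.codeword_near[OF code] by simp
qed

section \<open>Distance graphs with two distances\<close>

lemma closed_neighborhood_distance_graph_pair:
  assumes "0 < a" "0 < b"
  shows "closed_neighborhood (distance_graph {a, b}) z = {c. c - z \<in> cross a b}"
  unfolding closed_neighborhood_distance_graph cross_def insert_iff empty_iff
  using assms by (intro Collect_cong) linarith

lemma card_closed_neighborhood_distance_graph_pair:
  assumes "0 < a" "0 < b" "a \<noteq> b"
  shows "card (closed_neighborhood (distance_graph {a, b}) z) = 5"
proof -
  have "{c. c - z \<in> cross a b} = (+) z ` cross a b"
    by (auto simp: image_iff) (metis add.commute diff_add_cancel)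
  moreover have "card (cross a b) = 5"
    using assms by (simp add: cross_def card_insert_if)
  ultimately show ?thesis
    using assms by (simp add: closed_neighborhood_distance_graph_pair card_image)
qed

lemma five_le_two_distance_coloring_pair:
  assumes "0 < a" "0 < b" "a \<noteq> b" "two_distance_coloring (distance_graph {a, b}) k f"
  shows "5 \<le> k"
  using card_le_two_distance_coloring[OF assms(4) _
      pairwise_graph_dist_closed_neighborhood[OF sym_edges_distance_graph]]
    card_closed_neighborhood_distance_graph_pair[OF assms(1-3)]
  by simp

lemma six_le_two_distance_coloring_pair:
  assumes pos: "0 < a" "0 < b" and "a \<noteq> b"
    and coprime: "coprime (2 * a + b) (a - 2 * b)" "coprime (2 * b + a) (b - 2 * a)"
    and coloring: "two_distance_coloring (distance_graph {a, b}) k f"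
  shows "6 \<le> k"
proof (rule ccontr)
  assume "\<not> 6 \<le> k"
  then have "k = 5"
    using five_le_two_distance_coloring_pair[OF pos \<open>a \<noteq> b\<close> coloring] by simp
  let ?C = "{v \<in> verts (distance_graph {a, b}). f v = 1}"
  have "perfect_code (distance_graph {a, b}) ?C"
    using coloring \<open>k = 5\<close> card_closed_neighborhood_distance_graph_pair[OF pos \<open>a \<noteq> b\<close>]
    by (intro perfect_code_color_class[where k = 5] sym_edges_distance_graph) auto
  then have "cross_code a b ?C"
    using pos \<open>a \<noteq> b\<close>
    by unfold_locales (auto simp: perfect_code_def closed_neighborhood_distance_graph_pair)
  then show False using no_cross_code_if_coprime[OF coprime] by blast
qed

section \<open>The graphs \<open>G\<^sub>t\<close>\<close>

lemma close_differences_2_t: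
  assumes "t > 2"
  shows "close_differences {2, t} = {2, t, 4, 2 * t, t + 2, t - 2}"
  using close_differences_pair[of 2 t] assms by (simp add: add.commute)

lemma coprime_knight_moves_2_t:
  fixes t :: int
  assumes "t mod 10 \<in> {3, 5, 7}"
  shows "coprime (2 * 2 + t) (2 - 2 * t)" "coprime (2 * t + 2) (t - 2 * 2)"
proof -
  have coprime_10: "coprime x 10" if "odd x" "\<not> 5 dvd x" for x :: int
    using that coprime_mult_right_iff[of x 2 5] prime_imp_coprime[of 5 x]
    by (simp add: coprime_commute)
  have "odd (t + 4)" "\<not> 5 dvd t + 4" "odd (t - 4)" "\<not> 5 dvd t - 4"
    using assms unfolding insert_iff empty_iff by presburger+
  then have "coprime (t + 4) 10" "coprime (t - 4) 10"
    using coprime_10 by blast+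
  moreover have "gcd (t + 4) (2 - 2 * t) = gcd (t + 4) 10"
    using gcd_add_mult[of "t + 4" 2 "2 - 2 * t"] by (simp add: algebra_simps)
  moreover have "gcd (t - 4) (2 * t + 2) = gcd (t - 4) 10"
    using gcd_add_mult[of "t - 4" 2 10] by (simp add: algebra_simps)
  ultimately show "coprime (2 * 2 + t) (2 - 2 * t)" "coprime (2 * t + 2) (t - 2 * 2)"
    by (simp_all add: coprime_iff_gcd_eq_1 add.commute gcd.commute)
qed

lemma six_coloring_Gt_if_3_dvd:
  assumes "t > 3" "odd t" "3 dvd t"
  shows "two_distance_coloring (Gt t) 6 (circular_coloring (t + 1) ((t + 3) div 6))"
proof -
  define q where "q = (t + 3) div 6"
  have t: "t = 6 * q - 3" "q \<ge> 2" using assms unfolding q_def by presburger+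
  have "\<exists>r\<in>{q..t + 1 - q}. [q * d = r] (mod t + 1)" if "d \<in> close_differences {2, t}" for d
  proof -
    have "t + 1 dvd 1 + t" "t + 1 dvd 2 * t + 2"
      by (auto intro: dvdI[of _ _ 1] dvdI[of _ _ 2])
    then have "\<exists>e\<in>{1, 2, 3, 4}. [d = e] (mod t + 1) \<or> [d = - e] (mod t + 1)"
      using that assms(1) by (auto simp: close_differences_2_t cong_iff_dvd_diff)
    moreover have "{1, 2, 3, 4} = {1..4::int}"
      by auto
    ultimately obtain e where "e \<in> {1..4}" "[d = e] (mod t + 1) \<or> [d = - e] (mod t + 1)"
      by metis
    then show ?thesis using t by (intro ex_residue_if_cong_small[of q e 4]) auto
  qed
  then show ?thesis
    using t unfolding Gt_def q_def[symmetric] by (intro two_distance_coloring_circular) auto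
qed

lemma chi2_Gt_eq_5:
  assumes "t > 3" "t mod 10 \<in> {1, 9}"
  shows "chi2 (Gt t) = 5"
proof -
  have "t > 2" using assms(1) by simp
  have "\<not> 5 dvd d" if "d \<in> close_differences {2, t}" for d
    using that assms unfolding close_differences_2_t[OF \<open>t > 2\<close>] insert_iff empty_iff
    by presburger
  then have "two_distance_coloring (Gt t) 5 (circular_coloring 5 1)"
    using two_distance_coloring_mod[of 5] by (simp add: Gt_def)
  moreover have "5 \<le> k" if "two_distance_coloring (Gt t) k f" for k f
    using that assms(1) five_le_two_distance_coloring_pair[of 2 t] by (simp add: Gt_def)
  ultimately show ?thesis using chi2_eqI[of "Gt t" 5] by (simp add: numeral_eq_enat)
qed

lemma chi2_Gt_eq_6:
  assumes "t > 3" "t mod 10 \<in> {3, 5, 7}"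
  shows "chi2 (Gt t) = 6"
proof -
  have "odd t" using assms(2) unfolding insert_iff empty_iff by presburger
  have "\<exists>f. two_distance_coloring (Gt t) 6 f"
  proof (cases "3 dvd t")
    case True
    then show ?thesis using six_coloring_Gt_if_3_dvd assms(1) \<open>odd t\<close> by blast
  next
    case False
    then have "\<not> 6 dvd d" if "d \<in> {2, t, 4, 2 * t, t + 2, t - 2}" for d
      using that \<open>odd t\<close> unfolding insert_iff empty_iff by presburger
    then show ?thesis
      using two_distance_coloring_mod[of 6 "{2, t}"] close_differences_2_t[of t] assms(1)
      by (auto simp: Gt_def)
  qed
  then obtain f where "two_distance_coloring (Gt t) 6 f" ..
  moreover have "6 \<le> k" if "two_distance_coloring (Gt t) k g" for k g
    using that assms(1) coprime_knight_moves_2_t[OF assms(2)]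
      six_le_two_distance_coloring_pair[of 2 t] by (simp add: Gt_def)
  ultimately show ?thesis using chi2_eqI[of "Gt t" 6] by (simp add: numeral_eq_enat)
qed

lemma chi2_Gt_3_eq_7: "chi2 (Gt 3) = 7"
proof -
  have differences: "close_differences {2, 3} = {1..6}"
    by (auto simp: close_differences_2_t)
  have "\<not> 7 dvd d" if "d \<in> {1..6}" for d :: int
    using that zdvd_imp_le[of 7 d] by auto
  then have "two_distance_coloring (Gt 3) 7 (circular_coloring 7 1)"
    using two_distance_coloring_mod[of 7 "{2, 3}"] by (simp add: Gt_def differences)
  moreover have "7 \<le> k" if "two_distance_coloring (Gt 3) k f" for k f
  proof -
    have "pairwise (\<lambda>u v. graph_dist (Gt 3) u v \<le> 2) {0..6}"
      by (auto simp: pairwise_def Gt_def graph_dist_distance_graph_le_2_iff differences)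
    then show ?thesis
      using card_le_two_distance_coloring[OF that, of "{0..6}"] by (simp add: Gt_def)
  qed
  ultimately show ?thesis using chi2_eqI[of "Gt 3" 7] by (simp add: numeral_eq_enat)
qed

theorem theorem9:
  shows "(\<forall>t::int. odd t \<and> t > 3 \<longrightarrow>
            ([t = 1] (mod 10) \<or> [t = 9] (mod 10) \<longrightarrow> chi2 (Gt t) = 5) \<and>
            ([t = 3] (mod 10) \<or> [t = 5] (mod 10) \<or> [t = 7] (mod 10) \<longrightarrow> chi2 (Gt t) = 6))
         \<and> chi2 (Gt 3) = 7"
proof (intro conjI allI impI)
  fix t :: int assume t: "odd t \<and> t > 3"
  show "chi2 (Gt t) = 5" if "[t = 1] (mod 10) \<or> [t = 9] (mod 10)"
    using chi2_Gt_eq_5 t that by (auto simp: cong_def)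
  show "chi2 (Gt t) = 6" if "[t = 3] (mod 10) \<or> [t = 5] (mod 10) \<or> [t = 7] (mod 10)"
    using chi2_Gt_eq_6 t that by (auto simp: cong_def)
qed (fact chi2_Gt_3_eq_7)

end
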